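(* Let $K, M, N, L$ be positive integers, let $M_{\mathrm{tot}} = KM$, and let $\sigma^2>0$. For each $n \in \{1,\dots,N\}$ let $\epsilon_n\in(0,1)$ and let $\mathbf{R}_n=\mathrm{bdiag}(\rho_{1n}\mathbf{I}_M,\dots,\rho_{Kn}\mathbf{I}_M)$ with real numbers $\rho_{kn}\ge 0$. Let $\mathbf{x}_n = a_n\mathbf{h}_n$ with $a_n\sim\mathrm{Bernoulli}(\epsilon_n)$ and $\mathbf{h}_n\sim\mathcal{CN}(\mathbf{0},\mathbf{R}_n)$ independent. Define the state evolution with the MMSE denoiser as follows: $$\bm{\Sigma}^0=\sigma^2\mathbf{I}+\frac{1}{L}\sum_{n=1}^N \mathbf{R}_n,$$ and for $t\ge 0$, $$\bm{\Sigma}^{t+1}=\sigma^2\mathbf{I}+\frac{1}{L}\sum_{n=1}^N\mathbb{E}\Big[\big(\mathbf{g}_{t,n}(\mathbf{x}_n+\mathbf{v}^t)-\mathbf{x}_n\big)\big(\mathbf{g}_{t,n}(\mathbf{x}_n+\mathbf{v}^t)-\mathbf{x}_n\big)^H\Big],$$ where $\mathbf{v}^t\sim\mathcal{CN}(\mathbf{0},\bm{\Sigma}^t)$ is independent of $\mathbf{x}_n$, and $\mathbf{g}_{t,n}(\bm{\xi})=\mathbb{E}[\mathbf{x}_n\mid \mathbf{x}_n+\mathbf{v}^t=\bm{\xi}]$ is the MMSE denoiser, explicitly $$\mathbf{g}_{t,n}(\bm{\xi})=\Big(1+\tfrac{1-\epsilon_n}{\epsilon_n}\tfrac{|\mathbf{R}_n+\bm{\Sigma}^t|}{|\bm{\Sigma}^t|}\exp\big(-\bm{\xi}^H\bm{\Omega}_n^t\bm{\xi}\big)\Big)^{-1}\mathbf{R}_n(\mathbf{R}_n+\bm{\Sigma}^t)^{-1}\bm{\xi},\qquad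 \bm{\Omega}_n^t=(\bm{\Sigma}^t)^{-1}-(\mathbf{R}_n+\bm{\Sigma}^t)^{-1},$$ with $|\cdot|$ denoting the determinant. Then for every $t\ge0$ there exist real numbers $\tau^t_1,\dots,\tau^t_K$ such that $\bm{\Sigma}^t=\mathrm{bdiag}(\tau^t_1\mathbf{I}_M,\dots,\tau^t_K\mathbf{I}_M)$.
   Context: $\mathrm{bdiag}(\mathbf{A}_1,\dots,\mathbf{A}_K)$ denotes the block-diagonal matrix with diagonal blocks $\mathbf{A}_1,\dots,\mathbf{A}_K$; $\mathbf{I}_M$ is the $M\times M$ identity. $\mathcal{CN}(\mathbf{0},\mathbf{C})$ denotes the circularly-symmetric complex Gaussian distribution with covariance $\mathbf{C}$. The expectation in the state evolution is over the joint distribution of $\mathbf{x}_n$ and $\mathbf{v}^t$; $(\cdot)^H$ is the conjugate transpose. *)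

theory Defs
  imports "HOL-Probability.Probability"
begin

text \<open>Block-diagonal matrix bdiag(c_1 I_M, ..., c_K I_M); coordinates of C^(KM) are
  indexed by pairs (k,m), k ranging over the K blocks and m over the M entries of a block.\<close>
definition bdiag :: "('k::finite \<Rightarrow> complex) \<Rightarrow> complex^('k \<times> 'm::finite)^('k \<times> 'm)" where
  "bdiag c = (\<chi> i j. if i = j then c (fst i) else 0)"

text \<open>Conjugate transpose.\<close>
definition mat_H :: "complex^'n::finite^'m::finite \<Rightarrow> complex^'m^'n" where
  "mat_H A = (\<chi> i j. cnj (A $ j $ i))"

text \<open>Outer product e e^H.\<close>
definition outer :: "complex^'n::finite \<Rightarrow> complex^'n^'n" where
  "outer e = (\<chi> i j. e $ i * cnj (e $ j))"

text \<open>Standard circularly-symmetric complex Gaussian CN(0, I) on C^n.\<close>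
definition std_cgauss :: "(complex^'i::finite) measure" where
  "std_cgauss = density lborel (\<lambda>x. ennreal (exp (- (norm x)\<^sup>2) / pi ^ CARD('i)))"

text \<open>CN(0, C): law of A z with z ~ CN(0,I) and A A^H = C (this law depends only on C).\<close>
definition cgauss :: "complex^'i^'i \<Rightarrow> (complex^'i::finite) measure" where
  "cgauss C = distr std_cgauss borel (\<lambda>z. (SOME A :: complex^'i^'i. A ** mat_H A = C) *v z)"

text \<open>Law of x = a h with a ~ Bernoulli(eps), h ~ CN(0,R) independent.\<close>
definition bg_prior :: "real \<Rightarrow> complex^'i^'i \<Rightarrow> (complex^'i::finite) measure" where
  "bg_prior eps R = distr (measure_pmf (bernoulli_pmf eps) \<Otimes>\<^sub>M cgauss R) borel
      (\<lambda>(a, h). if a then h else 0)"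

text \<open>Explicit MMSE denoiser g(xi) for prior bg_prior eps R and noise covariance S.\<close>
definition mmse_den :: "real \<Rightarrow> complex^'i^'i \<Rightarrow> complex^'i^'i \<Rightarrow> complex^'i \<Rightarrow> complex^'i::finite" where
  "mmse_den eps R S xi =
     (let Om = matrix_inv S - matrix_inv (R + S);
          q = (\<Sum>i\<in>UNIV. cnj (xi $ i) * (Om *v xi) $ i)
      in inverse (1 + complex_of_real ((1 - eps) / eps) * (det (R + S) / det S) * exp (- q))
         *s ((R ** matrix_inv (R + S)) *v xi))"

text \<open>State evolution Sigma^t.\<close>
primrec SE :: "real \<Rightarrow> nat \<Rightarrow> nat \<Rightarrow> (nat \<Rightarrow> real) \<Rightarrow> (nat \<Rightarrow> complex^'i^'i) \<Rightarrow> nat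
               \<Rightarrow> complex^'i::finite^'i" where
  "SE s2 L N eps R 0 = s2 *\<^sub>R mat 1 + (1 / real L) *\<^sub>R (\<Sum>n\<in>{1..N}. R n)"
| "SE s2 L N eps R (Suc t) =
     (let S = SE s2 L N eps R t in
      s2 *\<^sub>R mat 1 + (1 / real L) *\<^sub>R
        (\<Sum>n\<in>{1..N}. \<integral>p. outer (mmse_den (eps n) (R n) S (fst p + snd p) - fst p)
                         \<partial>(bg_prior (eps n) (R n) \<Otimes>\<^sub>M cgauss S)))"

end

theory Submission
  imports Defs
begin

text \<open>Induction on \<open>t\<close>: if \<open>\<Sigma>\<^sup>t = bdiag(\<tau>)\<close> with \<open>\<tau> > 0\<close>, then so is \<open>\<Sigma>\<^sup>t\<^sup>+\<^sup>1\<close>.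
  Changing the sign of one coordinate, or swapping two coordinates of the same block, is a
  Householder reflection along a common eigenvector of \<open>R\<^sub>n\<close> and \<open>\<Sigma>\<^sup>t\<close>. Such a reflection
  preserves \<open>CN(0,R\<^sub>n)\<close> and \<open>CN(0,\<Sigma>\<^sup>t)\<close> (a Gaussian is invariant under unitary maps
  fixing its covariance), hence also the Bernoulli-Gaussian prior, and the explicit MMSE denoiser
  commutes with it. So the error covariance is invariant under conjugation by these signed
  permutations: sign changes kill its off-diagonal entries and swaps make its diagonal constant
  on each block. The diagonal entries are expected squared moduli, hence nonnegative reals, which
  gives \<open>\<tau>\<^sup>t\<^sup>+\<^sup>1 \<ge> \<sigma>\<^sup>2 > 0\<close>.\<close>

section \<open>Orthogonal invariance of Lebesgue measure\<close>

lemma borel_measurable_linear: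
  fixes f :: "'a::euclidean_space \<Rightarrow> 'b::euclidean_space"
  shows "linear f \<Longrightarrow> f \<in> borel_measurable borel"
  by (intro borel_measurable_continuous_onI linear_continuous_on linear_conv_bounded_linear[THEN iffD1])

lemma lborel_distr_orthogonal_transformation_cart:
  fixes f :: "real^'n::{finite,wellorder} \<Rightarrow> real^'n::{finite,wellorder}"
  assumes f: "orthogonal_transformation f"
  shows "distr lborel borel f = lborel"
proof (rule lborel_eqI[symmetric])
  have f_meas: "f \<in> borel_measurable borel"
    using f by (simp add: borel_measurable_linear orthogonal_transformation_linear)
  define g where "g = inv f"
  have g: "orthogonal_transformation g"
    unfolding g_def using f by (rule orthogonal_transformation_inv)
  have vimage_f: "f -` S = g ` S" for S
    unfolding g_def using orthogonal_transformation_bij[OF f] by (simp add: bij_vimage_eq_inv_image)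
  fix l u :: "real^'n::{finite,wellorder}"
  assume lu: "\<And>b. b \<in> Basis \<Longrightarrow> l \<bullet> b \<le> u \<bullet> b"
  have g_box: "g ` box l u \<in> lmeasurable"
    by (rule measurable_orthogonal_image[OF g]) simp
  have "g ` box l u \<in> sets borel"
    using measurable_sets_borel[OF f_meas, of "box l u"] by (simp add: vimage_f)
  then have "emeasure (distr lborel borel f) (box l u) = emeasure lebesgue (g ` box l u)"
    using f_meas by (simp add: emeasure_distr vimage_f emeasure_completion)
  also have "\<dots> = ennreal (measure lebesgue (box l u))"
    using g_box by (simp add: emeasure_eq_measure2 measure_orthogonal_image[OF g])
  also have "\<dots> = emeasure lborel (box l u)"
    by (simp add: emeasure_eq_measure2 emeasure_completion[symmetric])
  finally show "emeasure (distr lborel borel f) (box l u) = (\<Prod>b\<in>Basis. (u - l) \<bullet> b)"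
    using lu by (simp add: emeasure_lborel_box_eq)
qed simp

text \<open>The library's change of variables is stated for \<open>real^'n\<close> with a well-ordered index
  type; coordinates with respect to \<open>Basis\<close> carry it over to every Euclidean space.\<close>

typedef (overloaded) ('a::euclidean_space) basis_idx = "Basis :: 'a set"
  using nonempty_Basis by blast

lemma bij_betw_Rep_basis_idx: "bij_betw Rep_basis_idx UNIV (Basis :: 'a::euclidean_space set)"
  by (metis bij_betw_def inj_on_def type_definition.Rep_inject type_definition.Rep_range
      type_definition_basis_idx)

instance basis_idx :: (euclidean_space) finite
  by standard (metis bij_betw_Rep_basis_idx bij_betw_finite finite_Basis)

instantiation basis_idx :: (euclidean_space) wellorder
begin

definition less_eq_basis_idx :: "'a basis_idx \<Rightarrow> 'a basis_idx \<Rightarrow> bool"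
  where "less_eq_basis_idx x y \<longleftrightarrow> to_nat x \<le> to_nat y"

definition less_basis_idx :: "'a basis_idx \<Rightarrow> 'a basis_idx \<Rightarrow> bool"
  where "less_basis_idx x y \<longleftrightarrow> to_nat x < to_nat y"

instance
proof
  fix P :: "'a basis_idx \<Rightarrow> bool" and a :: "'a basis_idx"
  assume step: "\<And>x. (\<And>y. y < x \<Longrightarrow> P y) \<Longrightarrow> P x"
  show "P a"
    by (induction "to_nat a" arbitrary: a rule: less_induct) (use step in \<open>auto simp: less_basis_idx_def\<close>)
qed (auto simp: less_eq_basis_idx_def less_basis_idx_def)

end

definition basis_coords :: "'a::euclidean_space \<Rightarrow> real^'a basis_idx" where
  "basis_coords x = (\<chi> i. x \<bullet> Rep_basis_idx i)"

definition from_basis_coords :: "real^'a basis_idx \<Rightarrow> 'a::euclidean_space" where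
  "from_basis_coords y = (\<Sum>i\<in>UNIV. y $ i *\<^sub>R Rep_basis_idx i)"

lemma from_basis_coords_inverse: "from_basis_coords (basis_coords x) = x"
  using sum.reindex_bij_betw[OF bij_betw_Rep_basis_idx, of "\<lambda>b. (x \<bullet> b) *\<^sub>R b"]
  by (simp add: from_basis_coords_def basis_coords_def euclidean_representation)

lemma inner_from_basis_coords:
  assumes b: "b \<in> Basis"
  shows "from_basis_coords y \<bullet> b = y $ Abs_basis_idx b"
proof -
  have "y $ i * (Rep_basis_idx i \<bullet> b) = (if i = Abs_basis_idx b then y $ i else 0)" for i
    using b Rep_basis_idx[of i] by (auto simp: inner_Basis Abs_basis_idx_inverse Rep_basis_idx_inverse)
  then show ?thesis
    by (simp add: from_basis_coords_def inner_sum_left)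
qed

lemma basis_coords_inverse: "basis_coords (from_basis_coords y) = y"
  by (simp add: basis_coords_def vec_eq_iff inner_from_basis_coords Rep_basis_idx Rep_basis_idx_inverse)

lemma linear_basis_coords: "linear basis_coords"
  by (auto simp: basis_coords_def linear_iff vec_eq_iff inner_add_left)

lemma linear_from_basis_coords: "linear from_basis_coords"
  by (auto simp: from_basis_coords_def linear_iff scaleR_add_left sum.distrib scaleR_sum_right)

lemma norm_basis_coords: "norm (basis_coords x) = norm x"
proof -
  have "(norm (basis_coords x))\<^sup>2 = (\<Sum>i\<in>UNIV. (x \<bullet> Rep_basis_idx i)\<^sup>2)"
    by (simp add: basis_coords_def norm_vec_def L2_set_def sum_nonneg)
  also have "\<dots> = (\<Sum>b\<in>Basis. (x \<bullet> b)\<^sup>2)"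
    by (rule sum.reindex_bij_betw[OF bij_betw_Rep_basis_idx])
  also have "\<dots> = x \<bullet> x"
    by (simp add: euclidean_inner[of x x] power2_eq_square)
  also have "\<dots> = (norm x)\<^sup>2"
    by (simp add: power2_norm_eq_inner)
  finally show ?thesis by simp
qed

lemma norm_from_basis_coords: "norm (from_basis_coords y) = norm y"
  by (metis norm_basis_coords basis_coords_inverse)

lemma vimage_basis_coords_box:
  "basis_coords -` box l u = box (from_basis_coords l) (from_basis_coords u)"
proof -
  have "basis_coords x \<in> box l u \<longleftrightarrow>
        (\<forall>b\<in>Basis. l $ Abs_basis_idx b < x \<bullet> b \<and> x \<bullet> b < u $ Abs_basis_idx b)" for x
    unfolding mem_box_cart basis_coords_def vec_lambda_beta
    by (metis Abs_basis_idx_inverse Rep_basis_idx Rep_basis_idx_inverse)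
  then show ?thesis
    by (auto simp: mem_box inner_from_basis_coords)
qed

lemma lborel_distr_basis_coords: "distr lborel borel (basis_coords :: 'a::euclidean_space \<Rightarrow> _) = lborel"
proof (rule lborel_eqI[symmetric])
  fix l u :: "real^'a basis_idx"
  assume lu: "\<And>b. b \<in> Basis \<Longrightarrow> l \<bullet> b \<le> u \<bullet> b"
  have "from_basis_coords l \<bullet> b \<le> from_basis_coords u \<bullet> b" if "b \<in> Basis" for b
    using lu[of "axis (Abs_basis_idx b) 1"] that by (simp add: inner_from_basis_coords cart_eq_inner_axis)
  then have "emeasure (distr lborel borel basis_coords) (box l u)
      = (\<Prod>b\<in>(Basis::'a set). u $ Abs_basis_idx b - l $ Abs_basis_idx b)"
    by (simp add: emeasure_distr borel_measurable_linear[OF linear_basis_coords] vimage_basis_coords_box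
        emeasure_lborel_box_eq inner_diff_left inner_from_basis_coords)
  also have "\<dots> = (\<Prod>i\<in>UNIV. u $ i - l $ i)"
    using prod.reindex_bij_betw[OF bij_betw_Rep_basis_idx, of "\<lambda>b. u $ Abs_basis_idx b - l $ Abs_basis_idx b"]
    by (simp add: Rep_basis_idx_inverse)
  also have "\<dots> = (\<Prod>b\<in>Basis. (u - l) \<bullet> b)"
  proof -
    have B: "(Basis :: (real^'a basis_idx) set) = (\<lambda>i. axis i 1) ` UNIV"
      by (auto simp: Basis_vec_def)
    have "inj (\<lambda>i::'a basis_idx. axis i (1::real))"
      by (auto simp: inj_def axis_eq_axis)
    then show ?thesis
      unfolding B by (simp add: prod.reindex inner_axis)
  qed
  finally show "emeasure (distr lborel borel basis_coords) (box l u) = (\<Prod>b\<in>Basis. (u - l) \<bullet> b)" .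
qed simp

lemma lborel_distr_left_inverse:
  assumes "distr lborel borel f = lborel" "\<And>x. g (f x) = x"
    and "f \<in> borel_measurable borel" "g \<in> borel_measurable borel"
  shows "distr lborel borel g = lborel"
proof -
  have "distr lborel borel g = distr lborel borel (g \<circ> f)"
    by (subst (1) assms(1)[symmetric]) (simp add: distr_distr assms(3,4))
  also have "g \<circ> f = id" by (simp add: fun_eq_iff assms(2))
  finally show ?thesis by (simp add: id_def distr_id2)
qed

lemma lborel_distr_orthogonal_transformation:
  fixes Q :: "'a::euclidean_space \<Rightarrow> 'a"
  assumes Q: "orthogonal_transformation Q"
  shows "distr lborel borel Q = lborel"
proof -
  let ?\<phi> = "basis_coords :: 'a \<Rightarrow> _" and ?\<psi> = "from_basis_coords :: _ \<Rightarrow> 'a"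
  have meas: "?\<phi> \<in> borel_measurable borel" "?\<psi> \<in> borel_measurable borel" "Q \<in> borel_measurable borel"
    using Q by (simp_all add: borel_measurable_linear linear_basis_coords linear_from_basis_coords
        orthogonal_transformation_linear)
  have \<psi>: "distr lborel borel ?\<psi> = lborel"
    by (rule lborel_distr_left_inverse[OF lborel_distr_basis_coords from_basis_coords_inverse meas(1,2)])
  define f where "f = ?\<phi> \<circ> Q \<circ> ?\<psi>"
  have "orthogonal_transformation f"
    using Q by (auto simp: f_def orthogonal_transformation norm_basis_coords norm_from_basis_coords
        linear_basis_coords linear_from_basis_coords intro!: linear_compose)
  then have f: "distr lborel borel f = lborel" "f \<in> borel_measurable borel"
    by (simp_all add: lborel_distr_orthogonal_transformation_cart borel_measurable_linear
        orthogonal_transformation_linear)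
  have "Q = ?\<psi> \<circ> f \<circ> ?\<phi>"
    by (simp add: f_def fun_eq_iff from_basis_coords_inverse basis_coords_inverse)
  then have "distr lborel borel Q = distr (distr (distr lborel borel ?\<phi>) borel f) borel ?\<psi>"
    by (simp add: distr_distr meas f(2) measurable_comp[OF meas(1) f(2)] comp_assoc)
  then show ?thesis
    by (simp add: lborel_distr_basis_coords f(1) \<psi>)
qed

section \<open>Householder reflections of \<open>\<complex>\<^sup>n\<close>\<close>

definition cinner :: "complex^'n::finite \<Rightarrow> complex^'n \<Rightarrow> complex" where
  "cinner x y = (\<Sum>k\<in>UNIV. cnj (x $ k) * y $ k)"

definition householder :: "complex^'n::finite \<Rightarrow> complex^'n \<Rightarrow> complex^'n" where
  "householder c x = x - (2 / cinner c c * cinner c x) *s c"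

lemma cinner_add_right: "cinner x (y + z) = cinner x y + cinner x z"
  by (simp add: cinner_def algebra_simps sum.distrib)

lemma cinner_diff_left: "cinner (x - y) z = cinner x z - cinner y z"
  by (simp add: cinner_def algebra_simps sum_subtractf)

lemma cinner_diff_right: "cinner x (y - z) = cinner x y - cinner x z"
  by (simp add: cinner_def algebra_simps sum_subtractf)

lemma cinner_smult_left: "cinner (a *s x) y = cnj a * cinner x y"
  by (simp add: cinner_def algebra_simps sum_distrib_left)

lemma cinner_smult_right: "cinner x (a *s y) = a * cinner x y"
  by (simp add: cinner_def algebra_simps sum_distrib_left)

lemma cinner_scaleR_right: "cinner x (r *\<^sub>R y) = of_real r * cinner x y"
  unfolding cinner_def vector_scaleR_component
  by (simp add: scaleR_conv_of_real sum_distrib_left algebra_simps)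

lemma cinner_zero_left [simp]: "cinner 0 x = 0"
  by (simp add: cinner_def)

lemma cinner_commute: "cinner y x = cnj (cinner x y)"
  by (simp add: cinner_def mult.commute)

lemma cinner_self: "cinner x x = of_real ((norm x)\<^sup>2)"
proof -
  have "cinner x x = (\<Sum>k\<in>UNIV. of_real ((cmod (x $ k))\<^sup>2))"
    unfolding cinner_def by (rule sum.cong) (simp_all add: complex_norm_square[symmetric] mult.commute)
  also have "\<dots> = of_real ((norm x)\<^sup>2)"
    by (simp add: norm_vec_def L2_set_def sum_nonneg)
  finally show ?thesis .
qed

lemma cinner_self_eq_0_iff: "cinner x x = 0 \<longleftrightarrow> x = 0"
  by (simp add: cinner_self)

lemma cinner_axis_left: "cinner (axis i 1) x = x $ i"
proof -
  have "cinner (axis i 1) x = (\<Sum>k\<in>UNIV. if i = k then x $ k else 0)"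
    unfolding cinner_def by (rule sum.cong) (simp_all add: axis_def)
  then show ?thesis by simp
qed

lemma cinner_mat_H_left: "cinner (mat_H A *v c) z = cinner c (A *v z)"
proof -
  have "cinner (mat_H A *v c) z = (\<Sum>k\<in>UNIV. \<Sum>j\<in>UNIV. A $ j $ k * cnj (c $ j) * z $ k)"
    by (simp add: cinner_def matrix_vector_mult_def mat_H_def sum_distrib_right sum_distrib_left algebra_simps)
  also have "\<dots> = (\<Sum>j\<in>UNIV. \<Sum>k\<in>UNIV. A $ j $ k * cnj (c $ j) * z $ k)"
    by (rule sum.swap)
  also have "\<dots> = cinner c (A *v z)"
    by (simp add: cinner_def matrix_vector_mult_def sum_distrib_left algebra_simps)
  finally show ?thesis .
qed

lemma householder_zero [simp]: "householder 0 = id"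
  by (simp add: fun_eq_iff householder_def cinner_def)

lemma linear_householder: "linear (householder c)"
proof (rule linearI)
  show "householder c (x + y) = householder c x + householder c y" for x y
    by (simp add: householder_def cinner_add_right vec_eq_iff algebra_simps add_divide_distrib)
  show "householder c (r *\<^sub>R x) = r *\<^sub>R householder c x" for r x
  proof -
    have "householder c (r *\<^sub>R x) = r *\<^sub>R x - (of_real r * (2 / cinner c c * cinner c x)) *s c"
      unfolding householder_def cinner_scaleR_right by (simp add: algebra_simps)
    also have "\<dots> = r *\<^sub>R householder c x"
      unfolding householder_def vec_eq_iff vector_scaleR_component vector_minus_component
        vector_smult_component
      by (simp add: scaleR_conv_of_real algebra_simps)
    finally show ?thesis .
  qed
qed

lemma cinner_householder_self: "cinner (householder c x) (householder c x) = cinner x x"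
proof (cases "c = 0")
  case False
  obtain r where r: "cinner c c = of_real r" "r \<noteq> 0"
    using False cinner_self cinner_self_eq_0_iff by (metis of_real_0)
  define g where "g = cinner c x"
  have xc: "cinner x c = cnj g"
    unfolding g_def by (rule cinner_commute)
  have cnj_coeff: "cnj (2 / cinner c c * g) = 2 / cinner c c * cnj g"
    by (simp add: r)
  have "cinner (householder c x) (householder c x) = cinner x x - (2 / of_real r * g) * cnj g
      - (2 / of_real r * cnj g) * g + (2 / of_real r * cnj g) * (2 / of_real r * g) * of_real r"
    unfolding householder_def cinner_diff_left cinner_diff_right cinner_smult_left cinner_smult_right
      xc cnj_coeff
    by (simp add: r g_def[symmetric] algebra_simps)
  also have "\<dots> = cinner x x"
    using r(2) by (simp add: field_simps)
  finally show ?thesis .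
qed simp

lemma orthogonal_transformation_householder: "orthogonal_transformation (householder c)"
proof -
  have "norm (householder c x) = norm x" for x
    using cinner_householder_self[of c x] unfolding cinner_self of_real_eq_iff
    by (metis norm_ge_zero power2_eq_iff_nonneg)
  then show ?thesis
    by (simp add: orthogonal_transformation linear_householder)
qed

text \<open>Since \<open>CN(0, R)\<close> is the image of \<open>CN(0, I)\<close> under \<open>A\<close>, this turns a reflection along an
  eigenvector of \<open>R = A A\<^sup>H\<close> into an orthogonal change of variables for \<open>CN(0, I)\<close>.\<close>
lemma householder_matrix_vector_mult:
  assumes AR: "A ** mat_H A = R" and Rc: "R *v c = r *s c"
  shows "householder c (A *v z) = A *v householder (mat_H A *v c) z"
proof -
  define w where "w = mat_H A *v c"
  have Aw: "A *v w = r *s c"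
    by (simp add: w_def matrix_vector_mul_assoc AR Rc)
  have ww: "cinner w w = r * cinner c c"
    using cinner_mat_H_left[of A c w] by (simp add: w_def[symmetric] Aw cinner_smult_right)
  have wz: "cinner w z = cinner c (A *v z)"
    unfolding w_def by (rule cinner_mat_H_left)
  show ?thesis
  proof (cases "cinner w w = 0")
    case True
    then have "w = 0"
      by (simp add: cinner_self_eq_0_iff)
    then show ?thesis
      using wz by (simp add: householder_def w_def[symmetric])
  next
    case False
    then have "r \<noteq> 0" "cinner c c \<noteq> 0"
      using ww by auto
    then have "A *v householder w z = A *v z - (2 / cinner c c * cinner c (A *v z)) *s c"
      unfolding householder_def matrix_vector_mult_diff_distrib vector_scalar_commute Aw
      by (simp add: ww wz vector_smult_assoc)
    then show ?thesis
      by (simp add: householder_def w_def)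
  qed
qed

section \<open>Symmetries of the Gaussian and Bernoulli-Gaussian laws\<close>

lemma distr_std_cgauss_orthogonal_transformation:
  fixes W :: "complex^'i::finite \<Rightarrow> complex^'i"
  assumes W: "orthogonal_transformation W"
  shows "distr std_cgauss borel W = std_cgauss"
proof -
  define g where "g = (\<lambda>x::complex^'i. ennreal (exp (- (norm x)\<^sup>2) / pi ^ CARD('i)))"
  have W_meas: "W \<in> measurable lborel borel"
    using W by (simp add: borel_measurable_linear orthogonal_transformation_linear)
  have "g \<in> borel_measurable borel"
    unfolding g_def by measurable
  then have "density (distr lborel borel W) g = distr (density lborel (\<lambda>x. g (W x))) borel W"
    using W_meas by (rule density_distr)
  moreover have "(\<lambda>x. g (W x)) = g"
    using W by (simp add: g_def orthogonal_transformation fun_eq_iff)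
  ultimately show ?thesis
    by (simp add: std_cgauss_def g_def[symmetric] lborel_distr_orthogonal_transformation[OF W])
qed

lemma integrable_exp_neg_square: "integrable lborel (\<lambda>t::real. exp (- t\<^sup>2))"
proof -
  have "exp (- t\<^sup>2) = sqrt pi * normal_density 0 (sqrt (1/2)) t" for t :: real
    by (simp add: normal_density_def real_sqrt_mult)
  then show ?thesis by simp
qed

lemma finite_measure_std_cgauss: "finite_measure (std_cgauss :: (complex^'i::finite) measure)"
proof
  define h where "h = (\<lambda>t::real. ennreal (exp (- t\<^sup>2)))"
  have h_finite: "(\<integral>\<^sup>+t. h t \<partial>lborel) < \<infinity>"
    using integrableD(2)[OF integrable_exp_neg_square] by (simp add: h_def less_top)
  have density_prod: "ennreal (exp (- (norm x)\<^sup>2) / pi ^ CARD('i))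
      = ennreal (1 / pi ^ CARD('i)) * (\<Prod>b\<in>Basis. h (x \<bullet> b))" for x :: "complex^'i"
  proof -
    have "(norm x)\<^sup>2 = x \<bullet> x"
      by (simp add: power2_norm_eq_inner)
    also have "\<dots> = (\<Sum>b\<in>Basis. (x \<bullet> b)\<^sup>2)"
      by (simp add: euclidean_inner[of x x] power2_eq_square)
    finally have "(norm x)\<^sup>2 = (\<Sum>b\<in>Basis. (x \<bullet> b)\<^sup>2)" .
    then have "exp (- (norm x)\<^sup>2) = (\<Prod>b\<in>Basis. exp (- (x \<bullet> b)\<^sup>2))"
      by (simp add: exp_sum[symmetric] sum_negf)
    then show ?thesis
      by (simp add: h_def prod_ennreal ennreal_mult'[symmetric] divide_simps)
  qed
  have "emeasure (std_cgauss :: (complex^'i) measure) (space std_cgauss)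
      = (\<integral>\<^sup>+x. ennreal (exp (- (norm x)\<^sup>2) / pi ^ CARD('i)) \<partial>(lborel :: (complex^'i) measure))"
    by (simp add: std_cgauss_def emeasure_density)
  also have "\<dots> = ennreal (1 / pi ^ CARD('i)) *
      (\<integral>\<^sup>+x. (\<Prod>b\<in>Basis. h (x \<bullet> b)) \<partial>(lborel :: (complex^'i) measure))"
    unfolding density_prod by (rule nn_integral_cmult) (simp add: h_def)
  also have "\<dots> = ennreal (1 / pi ^ CARD('i)) * (\<Prod>b\<in>(Basis :: (complex^'i) set). \<integral>\<^sup>+t. h t \<partial>lborel)"
    by (subst nn_integral_lborel_prod) (simp_all add: h_def)
  also have "\<dots> \<noteq> \<infinity>"
    using h_finite by (simp add: ennreal_mult_eq_top_iff power_eq_top_ennreal)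
  finally show "emeasure (std_cgauss :: (complex^'i) measure) (space std_cgauss) \<noteq> \<infinity>" .
qed

lemma finite_measure_cgauss: "finite_measure (cgauss R)"
  unfolding cgauss_def
  by (rule finite_measure.finite_measure_distr[OF finite_measure_std_cgauss]) (simp add: std_cgauss_def borel_measurable_linear)

lemma sets_cgauss [simp]: "sets (cgauss R) = sets borel"
  by (simp add: cgauss_def)

lemma sets_bg_prior [simp]: "sets (bg_prior e R) = sets borel"
  by (simp add: bg_prior_def)

lemma distr_cgauss_householder:
  fixes R :: "complex^'i::finite^'i"
  assumes root: "\<exists>A :: complex^'i^'i. A ** mat_H A = R" and Rc: "R *v c = r *s c"
  shows "distr (cgauss R) borel (householder c) = cgauss R"
proof -
  define A :: "complex^'i^'i" where "A = (SOME A. A ** mat_H A = R)"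
  have AR: "A ** mat_H A = R"
    unfolding A_def using root by (rule someI_ex)
  have cgauss_R: "cgauss R = distr std_cgauss borel ((*v) A)"
    by (simp add: cgauss_def A_def)
  have meas: "householder c \<in> borel_measurable borel" "householder (mat_H A *v c) \<in> borel_measurable borel"
      "(*v) A \<in> borel_measurable borel"
    by (simp_all add: borel_measurable_linear linear_householder)
  have "householder c \<circ> (*v) A = (*v) A \<circ> householder (mat_H A *v c)"
    using householder_matrix_vector_mult[OF AR Rc] by (simp add: fun_eq_iff)
  then have "distr (cgauss R) borel (householder c)
      = distr (distr std_cgauss borel (householder (mat_H A *v c))) borel ((*v) A)"
    by (simp add: cgauss_R distr_distr meas std_cgauss_def)
  then show ?thesis
    by (simp add: distr_std_cgauss_orthogonal_transformation orthogonal_transformation_householder cgauss_R)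
qed

lemma measurable_select_if:
  assumes "sets N = sets borel"
  shows "(\<lambda>(a, h). if a then h else (0 :: 'b::real_normed_vector)) \<in> measurable (measure_pmf p \<Otimes>\<^sub>M N) borel"
proof -
  let ?M = "measure_pmf p \<Otimes>\<^sub>M N"
  have "snd \<in> measurable ?M borel"
    by (rule measurable_compose[OF measurable_snd measurable_ident_sets[OF assms]])
  moreover have "{x \<in> space ?M. fst x} \<in> sets ?M"
    using measurable_sets[OF measurable_fst, of "{True}" "measure_pmf p" N]
    by (simp add: vimage_def Int_def conj_commute)
  ultimately have "(\<lambda>x. if fst x then snd x else 0) \<in> measurable ?M borel"
    by (intro measurable_If) simp_all
  then show ?thesis
    by (simp add: split_beta')
qed

lemma distr_bg_prior_invariant:
  fixes T :: "complex^'i::finite \<Rightarrow> complex^'i"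
  assumes T_meas: "T \<in> borel_measurable borel" and T0: "T 0 = 0"
    and T_cgauss: "distr (cgauss R) borel T = cgauss R"
  shows "distr (bg_prior e R) borel T = bg_prior e R"
proof -
  let ?B = "measure_pmf (bernoulli_pmf e)" and ?C = "cgauss R"
  let ?select = "\<lambda>(a, h). if a then h else (0 :: complex^'i)"
  let ?T2 = "\<lambda>x. (fst x, T (snd x))"
  have T_meas': "T \<in> measurable ?C borel"
    using T_meas by (simp add: measurable_cong_sets[OF sets_cgauss refl])
  have T2_meas: "?T2 \<in> measurable (?B \<Otimes>\<^sub>M ?C) (?B \<Otimes>\<^sub>M borel)"
    by (rule measurable_Pair[OF measurable_fst measurable_compose[OF measurable_snd T_meas']])
  have "sigma_finite_measure (distr ?C borel T)"
    unfolding T_cgauss using finite_measure_cgauss by (rule finite_measure.axioms(1))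
  then have "distr ?B ?B (\<lambda>x. x) \<Otimes>\<^sub>M distr ?C borel T = distr (?B \<Otimes>\<^sub>M ?C) (?B \<Otimes>\<^sub>M borel) ?T2"
    using pair_measure_distr[OF _ T_meas', of "\<lambda>x. x" ?B ?B] by (simp add: split_beta')
  then have T2_inv: "distr (?B \<Otimes>\<^sub>M ?C) (?B \<Otimes>\<^sub>M borel) ?T2 = ?B \<Otimes>\<^sub>M ?C"
    by (simp add: T_cgauss)
  have "T \<circ> ?select = ?select \<circ> ?T2"
    using T0 by (auto simp: fun_eq_iff)
  then have "distr (bg_prior e R) borel T = distr (distr (?B \<Otimes>\<^sub>M ?C) (?B \<Otimes>\<^sub>M borel) ?T2) borel ?select"
    by (simp add: bg_prior_def distr_distr T_meas T2_meas measurable_select_if)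
  then show ?thesis
    by (simp add: T2_inv bg_prior_def)
qed

lemma integral_pair_measure_symmetry:
  fixes F :: "'a::euclidean_space \<times> 'a \<Rightarrow> 'b::{banach, second_countable_topology}"
  assumes M: "distr M borel T = M" "sets M = sets borel"
    and N: "distr N borel T = N" "sets N = sets borel" "finite_measure N"
    and T: "T \<in> borel_measurable borel"
    and F: "F \<in> borel_measurable (borel \<Otimes>\<^sub>M borel)"
    and FT: "\<And>x y. F (T x, T y) = L (F (x, y))"
    and L: "bounded_linear L" "\<And>m. L (L m) = m"
  shows "integral\<^sup>L (M \<Otimes>\<^sub>M N) F = L (integral\<^sup>L (M \<Otimes>\<^sub>M N) F)"
proof -
  have TM: "T \<in> measurable M borel" and TN: "T \<in> measurable N borel"
    using T by (simp_all add: measurable_cong_sets[OF M(2) refl] measurable_cong_sets[OF N(2) refl])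
  let ?TT = "\<lambda>p. (T (fst p), T (snd p))"
  have TT: "?TT \<in> measurable (M \<Otimes>\<^sub>M N) (borel \<Otimes>\<^sub>M borel)"
    by (rule measurable_Pair[OF measurable_compose[OF measurable_fst TM] measurable_compose[OF measurable_snd TN]])
  have "sigma_finite_measure (distr N borel T)"
    unfolding N(1) using N(3) by (rule finite_measure.axioms(1))
  then have "distr M borel T \<Otimes>\<^sub>M distr N borel T = distr (M \<Otimes>\<^sub>M N) (borel \<Otimes>\<^sub>M borel) ?TT"
    using pair_measure_distr[OF TM TN] by (simp add: split_beta')
  then have "integral\<^sup>L (M \<Otimes>\<^sub>M N) F = integral\<^sup>L (distr (M \<Otimes>\<^sub>M N) (borel \<Otimes>\<^sub>M borel) ?TT) F"
    by (simp add: M(1) N(1))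
  also have "\<dots> = integral\<^sup>L (M \<Otimes>\<^sub>M N) (\<lambda>p. L (F p))"
    using integral_distr[OF TT F] FT by (simp add: split_beta')
  also have "\<dots> = L (integral\<^sup>L (M \<Otimes>\<^sub>M N) F)"
    by (rule integral_bounded_linear'[OF L(1) L(1)]) (simp add: L(2))
  finally show ?thesis .
qed

section \<open>Block-diagonal matrices and signed permutations\<close>

lemma bdiag_nth: "bdiag c $ i $ j = (if i = j then c (fst i) else 0)"
  by (simp add: bdiag_def)

lemma sum_if_eq_mult: "(\<Sum>k\<in>(UNIV::'a::finite set). (if i = k then f k else 0) * g k) = f i * (g i :: complex)"
  by (simp add: if_distrib if_distribR cong: if_cong)

lemma bdiag_mult: "bdiag a ** bdiag b = (bdiag (\<lambda>k. a k * b k) :: complex^('k::finite \<times> 'm::finite)^('k \<times> 'm))"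
  unfolding vec_eq_iff matrix_matrix_mult_def bdiag_nth
  by (simp add: sum_if_eq_mult[where f = "\<lambda>k. a (fst _)"])

lemma bdiag_add: "bdiag a + bdiag b = (bdiag (\<lambda>k. a k + b k) :: complex^('k::finite \<times> 'm::finite)^('k \<times> 'm))"
  by (simp add: vec_eq_iff bdiag_nth)

lemma bdiag_diff: "bdiag a - bdiag b = (bdiag (\<lambda>k. a k - b k) :: complex^('k::finite \<times> 'm::finite)^('k \<times> 'm))"
  by (simp add: vec_eq_iff bdiag_nth)

lemma scaleR_bdiag: "r *\<^sub>R bdiag a = (bdiag (\<lambda>k. r *\<^sub>R a k) :: complex^('k::finite \<times> 'm::finite)^('k \<times> 'm))"
  by (simp add: vec_eq_iff bdiag_nth)

lemma mat_1_eq_bdiag: "mat 1 = (bdiag (\<lambda>k. 1) :: complex^('k::finite \<times> 'm::finite)^('k \<times> 'm))"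
  by (simp add: vec_eq_iff bdiag_nth mat_def)

lemma sum_bdiag: "(\<Sum>n\<in>A. bdiag (a n)) = (bdiag (\<lambda>k. \<Sum>n\<in>A. a n k) :: complex^('k::finite \<times> 'm::finite)^('k \<times> 'm))"
  unfolding vec_eq_iff
proof (intro allI)
  fix i j :: "'k \<times> 'm"
  show "(\<Sum>n\<in>A. bdiag (a n)) $ i $ j = (bdiag (\<lambda>k. \<Sum>n\<in>A. a n k) :: complex^('k \<times> 'm)^('k \<times> 'm)) $ i $ j"
    by (cases "i = j") (simp_all add: bdiag_nth)
qed

lemma bdiag_matrix_vector_mult: "bdiag a *v x = (\<chi> i. a (fst i) * x $ i)"
  unfolding vec_eq_iff matrix_vector_mult_def bdiag_nth
  by (simp add: sum_if_eq_mult[where f = "\<lambda>k. a (fst _)"])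

lemma mat_H_bdiag: "mat_H (bdiag a) = bdiag (\<lambda>k. cnj (a k))"
  by (simp add: vec_eq_iff mat_H_def bdiag_nth)

lemma matrix_inv_bdiag:
  assumes "\<And>k. a k \<noteq> 0"
  shows "matrix_inv (bdiag a :: complex^('k::finite \<times> 'm::finite)^('k \<times> 'm)) = bdiag (\<lambda>k. inverse (a k))"
proof -
  let ?A = "bdiag a :: complex^('k \<times> 'm)^('k \<times> 'm)"
    and ?B = "bdiag (\<lambda>k. inverse (a k)) :: complex^('k \<times> 'm)^('k \<times> 'm)"
  have AB: "?A ** ?B = mat 1" and BA: "?B ** ?A = mat 1"
    using assms by (simp_all add: bdiag_mult mat_1_eq_bdiag)
  show ?thesis
    unfolding matrix_inv_def
  proof (rule some_equality)
    fix X
    assume "?A ** X = mat 1 \<and> X ** ?A = mat 1"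
    then have "X = X ** (?A ** ?B)" "X ** ?A = mat 1"
      by (simp_all add: AB)
    then show "X = ?B"
      by (simp add: matrix_mul_assoc)
  qed (simp add: AB BA)
qed

lemma bdiag_nonneg_eq_mult_mat_H:
  assumes "\<And>k. r k \<ge> 0"
  shows "\<exists>A :: complex^('k::finite \<times> 'm::finite)^('k \<times> 'm). A ** mat_H A = bdiag (\<lambda>k. complex_of_real (r k))"
proof
  show "bdiag (\<lambda>k. complex_of_real (sqrt (r k))) ** mat_H (bdiag (\<lambda>k. complex_of_real (sqrt (r k))))
      = bdiag (\<lambda>k. complex_of_real (r k))"
    using assms by (simp add: mat_H_bdiag bdiag_mult of_real_mult[symmetric] del: of_real_mult)
qed

lemma bdiag_axis_eigenvector: "bdiag d *v axis i 1 = d (fst i) *s axis i 1"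
proof -
  have "(bdiag d *v axis i 1) $ a = (d (fst i) *s axis i 1) $ a" for a
    by (cases "a = i") (simp_all add: bdiag_matrix_vector_mult axis_def)
  then show ?thesis by (simp add: vec_eq_iff)
qed

lemma bdiag_axis_diff_eigenvector:
  assumes "fst i = fst j"
  shows "bdiag d *v (axis i 1 - axis j 1) = d (fst i) *s (axis i 1 - axis j 1)"
proof -
  have "(bdiag d *v (axis i 1 - axis j 1)) $ a = (d (fst i) *s (axis i 1 - axis j 1)) $ a" for a
    using assms by (cases "a = i"; cases "a = j") (simp_all add: bdiag_matrix_vector_mult axis_def)
  then show ?thesis by (simp add: vec_eq_iff)
qed

definition signed_perm :: "('i \<Rightarrow> complex) \<Rightarrow> ('i \<Rightarrow> 'i) \<Rightarrow> complex^'i::finite \<Rightarrow> complex^'i" where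
  "signed_perm s \<sigma> x = (\<chi> a. s a * x $ \<sigma> a)"

text \<open>\<open>P M P\<^sup>H\<close> for the matrix \<open>P\<close> of \<^const>\<open>signed_perm\<close> when the signs are real.\<close>
definition signed_perm_congruence :: "('i \<Rightarrow> complex) \<Rightarrow> ('i \<Rightarrow> 'i) \<Rightarrow> complex^'i::finite^'i \<Rightarrow> complex^'i^'i" where
  "signed_perm_congruence s \<sigma> M = (\<chi> a b. s a * s b * M $ \<sigma> a $ \<sigma> b)"

definition block_signed_involution :: "(('k \<times> 'm) \<Rightarrow> complex) \<Rightarrow> (('k \<times> 'm) \<Rightarrow> ('k \<times> 'm)) \<Rightarrow> bool" where
  "block_signed_involution s \<sigma> \<longleftrightarrow>
     (\<forall>a. fst (\<sigma> a) = fst a \<and> \<sigma> (\<sigma> a) = a \<and> (s a = 1 \<or> s a = -1) \<and> s (\<sigma> a) = s a)"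

lemma block_signed_involution_sign_flip: "block_signed_involution ((\<lambda>_. 1)(i := -1)) id"
  by (simp add: block_signed_involution_def)

lemma block_signed_involution_swap:
  assumes "fst i = fst j"
  shows "block_signed_involution (\<lambda>_. 1) (id(i := j, j := i))"
  using assms by (auto simp: block_signed_involution_def)

lemma signed_perm_add: "signed_perm s \<sigma> (x + y) = signed_perm s \<sigma> x + signed_perm s \<sigma> y"
  by (simp add: signed_perm_def vec_eq_iff algebra_simps)

lemma signed_perm_diff: "signed_perm s \<sigma> (x - y) = signed_perm s \<sigma> x - signed_perm s \<sigma> y"
  by (simp add: signed_perm_def vec_eq_iff algebra_simps)

lemma signed_perm_smult: "signed_perm s \<sigma> (c *s x) = c *s signed_perm s \<sigma> x"
  by (simp add: signed_perm_def vec_eq_iff algebra_simps)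

lemma signed_perm_zero: "signed_perm s \<sigma> 0 = 0"
  by (simp add: signed_perm_def vec_eq_iff)

lemma householder_eq_sign_flip:
  fixes i :: "'i::finite"
  shows "householder (axis i 1) = signed_perm ((\<lambda>_. 1)(i := -1)) id"
proof
  fix x :: "complex^'i"
  have "householder (axis i 1) x $ a = signed_perm ((\<lambda>_. 1)(i := -1)) id x $ a" for a
    unfolding householder_def cinner_axis_left
    by (cases "a = i") (simp_all add: signed_perm_def axis_def)
  then show "householder (axis i 1) x = signed_perm ((\<lambda>_. 1)(i := -1)) id x"
    by (simp add: vec_eq_iff)
qed

lemma householder_eq_swap:
  fixes i j :: "'i::finite"
  assumes "i \<noteq> j"
  shows "householder (axis i 1 - axis j 1) = signed_perm (\<lambda>_. 1) (id(i := j, j := i))"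
proof
  fix x :: "complex^'i"
  have "cinner (axis i 1 - axis j 1) (axis i 1 - axis j 1) = 2"
    unfolding cinner_diff_left cinner_axis_left using assms by (simp add: axis_def)
  then have "householder (axis i 1 - axis j 1) x $ a = signed_perm (\<lambda>_. 1) (id(i := j, j := i)) x $ a" for a
    unfolding householder_def cinner_diff_left cinner_axis_left
    using assms by (cases "a = i"; cases "a = j") (simp_all add: signed_perm_def axis_def)
  then show "householder (axis i 1 - axis j 1) x = signed_perm (\<lambda>_. 1) (id(i := j, j := i)) x"
    by (simp add: vec_eq_iff)
qed

lemma bounded_linear_signed_perm_congruence: "bounded_linear (signed_perm_congruence s \<sigma>)"
proof -
  have "linear (signed_perm_congruence s \<sigma>)"
    by (rule linearI) (simp_all add: signed_perm_congruence_def vec_eq_iff algebra_simps)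
  then show ?thesis
    by (simp add: linear_conv_bounded_linear)
qed

context
  fixes s :: "'k::finite \<times> 'm::finite \<Rightarrow> complex" and \<sigma> :: "'k \<times> 'm \<Rightarrow> 'k \<times> 'm"
  assumes inv: "block_signed_involution s \<sigma>"
begin

lemma signed_involution_sign_mult_self: "s a * s a = 1"
  using inv unfolding block_signed_involution_def by (metis mult_1 mult_minus1 minus_minus)

lemma signed_involution_cnj_sign: "cnj (s a) = s a"
  using inv unfolding block_signed_involution_def by (metis complex_cnj_one complex_cnj_minus)

lemma outer_signed_perm: "outer (signed_perm s \<sigma> x) = signed_perm_congruence s \<sigma> (outer x)"
  by (simp add: outer_def signed_perm_def signed_perm_congruence_def vec_eq_iff signed_involution_cnj_sign algebra_simps)

lemma signed_perm_congruence_involutive: "signed_perm_congruence s \<sigma> (signed_perm_congruence s \<sigma> M) = M"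
proof -
  have "\<And>a. \<sigma> (\<sigma> a) = a" "\<And>a. s (\<sigma> a) = s a"
    using inv by (auto simp: block_signed_involution_def)
  then have "signed_perm_congruence s \<sigma> (signed_perm_congruence s \<sigma> M) = (\<chi> a b. (s a * s a) * (s b * s b) * M $ a $ b)"
    by (simp add: signed_perm_congruence_def vec_eq_iff algebra_simps)
  then show ?thesis
    by (simp add: vec_eq_iff signed_involution_sign_mult_self)
qed

lemma bdiag_signed_perm: "bdiag d *v signed_perm s \<sigma> x = signed_perm s \<sigma> (bdiag d *v x)"
  using inv by (simp add: bdiag_matrix_vector_mult signed_perm_def vec_eq_iff block_signed_involution_def algebra_simps)

lemma bdiag_quadratic_form_signed_perm:
  "(\<Sum>i\<in>UNIV. cnj (signed_perm s \<sigma> x $ i) * (bdiag d *v signed_perm s \<sigma> x) $ i)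
     = (\<Sum>i\<in>UNIV. cnj (x $ i) * (bdiag d *v x) $ i)"
proof -
  have \<sigma>: "\<And>a. fst (\<sigma> a) = fst a" "\<And>a. \<sigma> (\<sigma> a) = a"
    using inv by (auto simp: block_signed_involution_def)
  have "cnj (signed_perm s \<sigma> x $ a) * (bdiag d *v signed_perm s \<sigma> x) $ a
      = (cnj (s a) * s a) * (cnj (x $ \<sigma> a) * (d (fst (\<sigma> a)) * x $ \<sigma> a))" for a
    by (simp add: signed_perm_def bdiag_matrix_vector_mult \<sigma>(1))
  then have "(\<Sum>i\<in>UNIV. cnj (signed_perm s \<sigma> x $ i) * (bdiag d *v signed_perm s \<sigma> x) $ i)
      = (\<Sum>a\<in>UNIV. cnj (x $ \<sigma> a) * (d (fst (\<sigma> a)) * x $ \<sigma> a))"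
    by (simp add: signed_involution_cnj_sign signed_involution_sign_mult_self)
  also have "\<dots> = (\<Sum>i\<in>UNIV. cnj (x $ i) * (bdiag d *v x) $ i)"
    by (rule sum.reindex_bij_witness[of _ \<sigma> \<sigma>]) (simp_all add: \<sigma>(2) bdiag_matrix_vector_mult)
  finally show ?thesis .
qed

lemma mmse_den_signed_perm:
  fixes \<rho> \<tau> :: "'k \<Rightarrow> complex"
  assumes "\<And>k. \<tau> k \<noteq> 0" and "\<And>k. \<rho> k + \<tau> k \<noteq> 0"
  shows "mmse_den e (bdiag \<rho> :: complex^('k \<times> 'm)^('k \<times> 'm)) (bdiag \<tau>) (signed_perm s \<sigma> x)
       = signed_perm s \<sigma> (mmse_den e (bdiag \<rho>) (bdiag \<tau>) x)"
proof -
  have inv_\<tau>: "matrix_inv (bdiag \<tau> :: complex^('k \<times> 'm)^('k \<times> 'm)) = bdiag (\<lambda>k. inverse (\<tau> k))"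
    and inv_\<rho>\<tau>: "matrix_inv (bdiag \<rho> + bdiag \<tau> :: complex^('k \<times> 'm)^('k \<times> 'm))
      = bdiag (\<lambda>k. inverse (\<rho> k + \<tau> k))"
    using assms by (simp_all add: matrix_inv_bdiag bdiag_add)
  show ?thesis
    unfolding mmse_den_def Let_def inv_\<tau> inv_\<rho>\<tau> bdiag_diff bdiag_mult bdiag_quadratic_form_signed_perm
    by (simp add: bdiag_signed_perm signed_perm_smult)
qed

end

section \<open>The error covariance of the MMSE denoiser\<close>

lemma borel_measurable_vec_nth:
  fixes f :: "'a \<Rightarrow> 'b::euclidean_space^'n::finite"
  shows "f \<in> borel_measurable M \<Longrightarrow> (\<lambda>x. f x $ i) \<in> borel_measurable M"
  by (rule measurable_compose[OF _ borel_measurable_linear]) (simp_all add: bounded_linear.linear[OF bounded_linear_vec_nth])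

lemma borel_measurable_vec_lambda:
  fixes f :: "'a \<Rightarrow> 'b::euclidean_space^'n::finite"
  assumes "\<And>i. (\<lambda>x. f x $ i) \<in> borel_measurable M"
  shows "f \<in> borel_measurable M"
proof -
  have "linear (\<lambda>y::'b. axis i y)" for i :: 'n
    by (rule linearI) (simp_all add: vec_eq_iff axis_def)
  then have "(\<lambda>x. \<Sum>i\<in>UNIV. axis i (f x $ i)) \<in> borel_measurable M"
    by (intro borel_measurable_sum measurable_compose[OF assms borel_measurable_linear])
  moreover have "(\<Sum>i\<in>UNIV. axis i (v $ i)) = v" for v :: "'b^'n"
    by (simp add: vec_eq_iff axis_def if_distrib cong: if_cong)
  ultimately show ?thesis
    by simp
qed

lemma borel_measurable_outer:
  assumes "f \<in> borel_measurable M"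
  shows "(\<lambda>x. outer (f x)) \<in> borel_measurable M"
proof -
  have nth: "(\<lambda>x. f x $ i) \<in> borel_measurable M" for i
    using assms by (rule borel_measurable_vec_nth)
  have "cnj \<in> borel_measurable borel"
    by (intro borel_measurable_continuous_onI continuous_intros)
  then have "(\<lambda>x. cnj (f x $ i)) \<in> borel_measurable M" for i
    by (rule measurable_compose[OF nth])
  then show ?thesis
    unfolding outer_def by (intro borel_measurable_vec_lambda) (simp add: nth borel_measurable_times)
qed

lemma borel_measurable_mmse_den: "mmse_den e R S \<in> borel_measurable borel"
proof -
  define Om where "Om = matrix_inv S - matrix_inv (R + S)"
  define K where "K = complex_of_real ((1 - e) / e) * (det (R + S) / det S)"
  define B where "B = R ** matrix_inv (R + S)"
  define D where "D = (\<lambda>xi. 1 + K * exp (- (\<Sum>i\<in>UNIV. cnj (xi $ i) * (Om *v xi) $ i)))"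
  have mmse_eq: "mmse_den e R S = (\<lambda>xi. \<chi> a. inverse (D xi) * (B *v xi) $ a)"
    by (simp add: mmse_den_def Let_def D_def Om_def K_def B_def fun_eq_iff vec_eq_iff)
  have "continuous_on UNIV D"
    unfolding D_def
    by (intro continuous_intros linear_continuous_on bounded_linear_compose[OF bounded_linear_vec_nth]
        linear_conv_bounded_linear[THEN iffD1] matrix_vector_mul_linear)
  moreover have "continuous_on UNIV (\<lambda>xi. (B *v xi) $ a)" for a
    by (intro linear_continuous_on bounded_linear_compose[OF bounded_linear_vec_nth]
        linear_conv_bounded_linear[THEN iffD1] matrix_vector_mul_linear)
  ultimately show ?thesis
    unfolding mmse_eq
    by (intro borel_measurable_vec_lambda)
      (simp add: borel_measurable_continuous_onI borel_measurable_times borel_measurable_inverse)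
qed

definition mse_matrix :: "real \<Rightarrow> complex^'i^'i \<Rightarrow> complex^'i^'i \<Rightarrow> complex^'i::finite^'i" where
  "mse_matrix e R S =
     (\<integral>p. outer (mmse_den e R S (fst p + snd p) - fst p) \<partial>(bg_prior e R \<Otimes>\<^sub>M cgauss S))"

lemma SE_Suc_mse_matrix:
  "SE s2 L N eps R (Suc t) =
     s2 *\<^sub>R mat 1 + (1 / real L) *\<^sub>R (\<Sum>n\<in>{1..N}. mse_matrix (eps n) (R n) (SE s2 L N eps R t))"
  by (simp add: mse_matrix_def Let_def)

lemma integral_outer_diag:
  fixes f :: "'a \<Rightarrow> complex^'i::finite"
  shows "\<exists>r \<ge> 0. (\<integral>x. outer (f x) \<partial>M) $ a $ a = complex_of_real r"
proof (cases "integrable M (\<lambda>x. outer (f x))")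
  case True
  have "bounded_linear (\<lambda>A :: complex^'i^'i. A $ a $ a)"
    by (rule bounded_linear_compose[OF bounded_linear_vec_nth bounded_linear_vec_nth])
  then have "(\<integral>x. outer (f x) \<partial>M) $ a $ a = (\<integral>x. outer (f x) $ a $ a \<partial>M)"
    using True by (rule integral_bounded_linear[symmetric])
  also have "\<dots> = (\<integral>x. complex_of_real ((cmod (f x $ a))\<^sup>2) \<partial>M)"
    unfolding outer_def vec_lambda_beta complex_norm_square ..
  also have "\<dots> = complex_of_real (\<integral>x. (cmod (f x $ a))\<^sup>2 \<partial>M)"
    by (rule integral_complex_of_real)
  finally show ?thesis
    by (intro exI[of _ "\<integral>x. (cmod (f x $ a))\<^sup>2 \<partial>M"]) simp
next
  case False
  then show ?thesis
    by (intro exI[of _ 0]) (simp add: not_integrable_integral_eq)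
qed

lemma mse_matrix_signed_perm_invariant:
  fixes \<rho> \<tau> :: "'k::finite \<Rightarrow> real" and c :: "complex^('k \<times> 'm::finite)"
  assumes inv: "block_signed_involution s \<sigma>" and T: "householder c = signed_perm s \<sigma>"
    and eigen: "\<And>d. (bdiag d :: complex^('k \<times> 'm)^('k \<times> 'm)) *v c = d k *s c"
    and \<rho>: "\<And>k. \<rho> k \<ge> 0" and \<tau>: "\<And>k. \<tau> k > 0"
  defines "R \<equiv> bdiag (\<lambda>k. complex_of_real (\<rho> k)) :: complex^('k \<times> 'm)^('k \<times> 'm)"
    and "S \<equiv> bdiag (\<lambda>k. complex_of_real (\<tau> k)) :: complex^('k \<times> 'm)^('k \<times> 'm)"
  shows "mse_matrix e R S = signed_perm_congruence s \<sigma> (mse_matrix e R S)"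
proof -
  define F where "F = (\<lambda>p. outer (mmse_den e R S (fst p + snd p) - fst p))"
  have T_meas: "signed_perm s \<sigma> \<in> borel_measurable borel"
    unfolding T[symmetric] by (simp add: borel_measurable_linear linear_householder)
  have cgauss_R: "distr (cgauss R) borel (signed_perm s \<sigma>) = cgauss R"
    unfolding T[symmetric] R_def
    by (rule distr_cgauss_householder[OF bdiag_nonneg_eq_mult_mat_H eigen]) (rule \<rho>)
  have cgauss_S: "distr (cgauss S) borel (signed_perm s \<sigma>) = cgauss S"
    unfolding T[symmetric] S_def
    by (rule distr_cgauss_householder[OF bdiag_nonneg_eq_mult_mat_H eigen]) (simp add: less_imp_le \<tau>)
  have bg_prior_R: "distr (bg_prior e R) borel (signed_perm s \<sigma>) = bg_prior e R"
    by (rule distr_bg_prior_invariant[OF T_meas signed_perm_zero cgauss_R])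
  have "complex_of_real (\<tau> k) \<noteq> 0" "complex_of_real (\<rho> k) + complex_of_real (\<tau> k) \<noteq> 0" for k
    using \<rho>[of k] \<tau>[of k] by (simp_all flip: of_real_add)
  then have F_equivariant: "F (signed_perm s \<sigma> x, signed_perm s \<sigma> y) = signed_perm_congruence s \<sigma> (F (x, y))" for x y
    unfolding F_def R_def S_def
    by (simp add: signed_perm_add[symmetric] signed_perm_diff[symmetric] mmse_den_signed_perm[OF inv]
        outer_signed_perm[OF inv])
  have F_meas: "F \<in> borel_measurable (borel \<Otimes>\<^sub>M borel)"
    unfolding F_def
    by (intro borel_measurable_outer borel_measurable_diff measurable_compose[OF _ borel_measurable_mmse_den])
      (auto simp: borel_prod intro!: borel_measurable_continuous_onI continuous_intros)
  have "integral\<^sup>L (bg_prior e R \<Otimes>\<^sub>M cgauss S) F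
      = signed_perm_congruence s \<sigma> (integral\<^sup>L (bg_prior e R \<Otimes>\<^sub>M cgauss S) F)"
    by (rule integral_pair_measure_symmetry[OF bg_prior_R _ cgauss_S _ finite_measure_cgauss T_meas F_meas
          F_equivariant bounded_linear_signed_perm_congruence signed_perm_congruence_involutive[OF inv]])
      simp_all
  then show ?thesis
    by (simp add: mse_matrix_def F_def)
qed

lemma mse_matrix_bdiag:
  fixes \<rho> \<tau> :: "'k::finite \<Rightarrow> real"
  assumes \<rho>: "\<And>k. \<rho> k \<ge> 0" and \<tau>: "\<And>k. \<tau> k > 0"
  shows "\<exists>\<epsilon>. (\<forall>k. \<epsilon> k \<ge> 0) \<and>
    mse_matrix e (bdiag (\<lambda>k. complex_of_real (\<rho> k))) (bdiag (\<lambda>k. complex_of_real (\<tau> k)))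
      = (bdiag (\<lambda>k. complex_of_real (\<epsilon> k)) :: complex^('k \<times> 'm::finite)^('k \<times> 'm))"
proof -
  define E where "E = (mse_matrix e (bdiag (\<lambda>k. complex_of_real (\<rho> k))) (bdiag (\<lambda>k. complex_of_real (\<tau> k)))
    :: complex^('k \<times> 'm)^('k \<times> 'm))"
  have off_diag: "E $ a $ b = 0" if "a \<noteq> b" for a b
  proof -
    have flip: "E = signed_perm_congruence ((\<lambda>_. 1)(a := -1)) id E"
      unfolding E_def
      by (rule mse_matrix_signed_perm_invariant[OF block_signed_involution_sign_flip householder_eq_sign_flip
            bdiag_axis_eigenvector \<rho> \<tau>])
    then have "E $ a $ b = signed_perm_congruence ((\<lambda>_. 1)(a := -1)) id E $ a $ b"
      by (rule arg_cong[where f = "\<lambda>M. M $ a $ b"])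
    also have "\<dots> = - E $ a $ b"
      using that by (simp add: signed_perm_congruence_def)
    finally show ?thesis
      by simp
  qed
  have block_const: "E $ a $ a = E $ b $ b" if "fst a = fst b" for a b
  proof (cases "a = b")
    case False
    have swap: "E = signed_perm_congruence (\<lambda>_. 1) (id(a := b, b := a)) E"
      unfolding E_def
      by (rule mse_matrix_signed_perm_invariant[OF block_signed_involution_swap[OF that]
            householder_eq_swap[OF False] bdiag_axis_diff_eigenvector[OF that] \<rho> \<tau>])
    then have "E $ a $ a = signed_perm_congruence (\<lambda>_. 1) (id(a := b, b := a)) E $ a $ a"
      by (rule arg_cong[where f = "\<lambda>M. M $ a $ a"])
    then show ?thesis
      by (simp add: signed_perm_congruence_def)
  qed simp
  have "\<forall>a. \<exists>r \<ge> 0. E $ a $ a = complex_of_real r"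
    unfolding E_def mse_matrix_def by (intro allI integral_outer_diag)
  from choice[OF this] obtain \<epsilon>' where \<epsilon>': "\<And>a. \<epsilon>' a \<ge> 0 \<and> E $ a $ a = complex_of_real (\<epsilon>' a)"
    by blast
  define \<epsilon> where "\<epsilon> k = \<epsilon>' (k, undefined)" for k
  have "E = bdiag (\<lambda>k. complex_of_real (\<epsilon> k))"
  proof -
    have "E $ a $ b = bdiag (\<lambda>k. complex_of_real (\<epsilon> k)) $ a $ b" for a b
      using off_diag[of a b] block_const[of a "(fst a, undefined)"] \<epsilon>'[of "(fst a, undefined)"]
      by (auto simp: bdiag_nth \<epsilon>_def)
    then show ?thesis
      by (simp add: vec_eq_iff)
  qed
  moreover have "\<forall>k. \<epsilon> k \<ge> 0"
    using \<epsilon>' by (simp add: \<epsilon>_def)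
  ultimately show ?thesis
    unfolding E_def by blast
qed

lemma noise_plus_bdiag_sum:
  fixes f :: "nat \<Rightarrow> 'k::finite \<Rightarrow> real"
  assumes "s2 > 0" and "\<And>n k. n \<in> A \<Longrightarrow> f n k \<ge> 0"
  shows "\<exists>\<tau>. (\<forall>k. \<tau> k > 0) \<and>
    s2 *\<^sub>R mat 1 + (1 / real L) *\<^sub>R (\<Sum>n\<in>A. bdiag (\<lambda>k. complex_of_real (f n k)))
      = (bdiag (\<lambda>k. complex_of_real (\<tau> k)) :: complex^('k \<times> 'm::finite)^('k \<times> 'm))"
proof (intro exI conjI allI)
  show "s2 + (\<Sum>n\<in>A. f n k) / real L > 0" for k
    using assms by (simp add: add_pos_nonneg sum_nonneg)
  show "s2 *\<^sub>R mat 1 + (1 / real L) *\<^sub>R (\<Sum>n\<in>A. bdiag (\<lambda>k. complex_of_real (f n k)))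
      = (bdiag (\<lambda>k. complex_of_real (s2 + (\<Sum>n\<in>A. f n k) / real L)) :: complex^('k \<times> 'm)^('k \<times> 'm))"
    unfolding mat_1_eq_bdiag scaleR_bdiag sum_bdiag bdiag_add
    by (simp add: scaleR_conv_of_real add_divide_distrib)
qed

lemma SE_bdiag_pos:
  fixes rho :: "'k::finite \<Rightarrow> nat \<Rightarrow> real"
  assumes s2: "s2 > 0" and rho: "\<And>k n. n \<in> {1..N} \<Longrightarrow> rho k n \<ge> 0"
  defines "R \<equiv> \<lambda>n. (bdiag (\<lambda>k. complex_of_real (rho k n)) :: complex^('k \<times> 'm::finite)^('k \<times> 'm))"
  shows "\<exists>\<tau>. (\<forall>k. \<tau> k > 0) \<and> SE s2 L N eps R t = bdiag (\<lambda>k. complex_of_real (\<tau> k))"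
proof (induction t)
  case 0
  have "\<exists>\<tau>. (\<forall>k. \<tau> k > 0) \<and>
      s2 *\<^sub>R mat 1 + (1 / real L) *\<^sub>R (\<Sum>n\<in>{1..N}. R n) = bdiag (\<lambda>k. complex_of_real (\<tau> k))"
    unfolding R_def by (rule noise_plus_bdiag_sum) (use s2 rho in auto)
  then show ?case
    by simp
next
  case (Suc t)
  then obtain \<tau> where \<tau>: "\<And>k. \<tau> k > 0" "SE s2 L N eps R t = bdiag (\<lambda>k. complex_of_real (\<tau> k))"
    by blast
  have "\<forall>n\<in>{1..N}. \<exists>\<epsilon>. (\<forall>k. \<epsilon> k \<ge> 0) \<and>
      mse_matrix (eps n) (R n) (SE s2 L N eps R t) = bdiag (\<lambda>k. complex_of_real (\<epsilon> k))"
    unfolding \<tau>(2) unfolding R_def by (intro ballI mse_matrix_bdiag) (use rho \<tau>(1) in auto)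
  then obtain \<epsilon> where \<epsilon>: "\<forall>n\<in>{1..N}. (\<forall>k. \<epsilon> n k \<ge> 0) \<and>
      mse_matrix (eps n) (R n) (SE s2 L N eps R t) = bdiag (\<lambda>k. complex_of_real (\<epsilon> n k))"
    by (rule bchoice[THEN exE])
  have "\<exists>\<tau>. (\<forall>k. \<tau> k > 0) \<and> s2 *\<^sub>R mat 1 + (1 / real L) *\<^sub>R
      (\<Sum>n\<in>{1..N}. bdiag (\<lambda>k. complex_of_real (\<epsilon> n k))) = bdiag (\<lambda>k. complex_of_real (\<tau> k))"
    by (rule noise_plus_bdiag_sum) (use s2 \<epsilon> in auto)
  then show ?case
    unfolding SE_Suc_mse_matrix using \<epsilon> by simp
qed

theorem corollary1:
  fixes rho :: "'k::finite \<Rightarrow> nat \<Rightarrow> real" and eps :: "nat \<Rightarrow> real"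
    and s2 :: real and N L :: nat
  assumes "N \<ge> 1" and "L \<ge> 1" and "s2 > 0"
    and "\<forall>n\<in>{1..N}. 0 < eps n \<and> eps n < 1"
    and "\<forall>k. \<forall>n\<in>{1..N}. rho k n \<ge> 0"
  shows "\<forall>t. \<exists>tau :: 'k \<Rightarrow> real.
           SE s2 L N eps
              (\<lambda>n. (bdiag (\<lambda>k. complex_of_real (rho k n)) :: complex^('k \<times> 'm::finite)^('k \<times> 'm))) t
           = bdiag (\<lambda>k. complex_of_real (tau k))"
  using SE_bdiag_pos[of s2 N rho L eps] assms(3,5) by blast

end
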